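(* Let $0<\alpha<1$, let $m,L\in\mathbb{N}$ with $m,L\ge 1$, let $\Delta t>0$, and put $T=m\Delta t$. Let $$\theta=T+(T+2T+4T+\cdots+2^{L-1}T)=2^L T ,$$ let $f\in C^2([0,\theta])$, and let $M=\max_{\tau\in[0,\theta]}|f''(\tau)|$. Let $D^\alpha f(\theta)$ be the exact Caputo fractional derivative of $f$ at the current time $\theta$, and let $D^\alpha_{L1} f(\theta)$ be its L1 approximation on the adaptive-memory grid on $[0,\theta]$ (both defined in the context). Then $$\left| D^\alpha f(\theta)-D^\alpha_{L1} f(\theta)\right| \le \frac{M}{2\Gamma(3-\alpha)}\left\{ \Delta t^{2-\alpha}A(m,\alpha)+\sum_{l=1}^{L}(2^{l-1}\Delta t)^{2-\alpha}B(m,\alpha)\right\},$$ where $$A(m,\alpha)=\sum_{k=0}^{m-1}\left[(m-k)^{1-\alpha}\{2(m-k-1)+\alpha\}-(m-k-1)^{1-\alpha}\{2(m-k)-\alpha\}\right],$$ $$B(m,\alpha)=\sum_{k=0}^{m-1}\left[(2m-k)^{1-\alpha}\{2(2m-k-1)+\alpha\}-(2m-k-1)^{1-\alpha}\{2(2m-k)-\alpha\}\right].$$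
   Context: For $0<\alpha<1$ the Caputo fractional derivative is $$D^\alpha f(t)=\frac{1}{\Gamma(1-\alpha)}\int_0^t \frac{f'(\tau)}{(t-\tau)^{\alpha}}\,d\tau .$$ Given a (possibly non-uniform) grid $0=t^0<t^1<\cdots<t^n$, the L1 approximation of $D^\alpha f$ at $t^n$ is $$D^\alpha_{L1} f(t^n)=\frac{1}{\Gamma(1-\alpha)}\sum_{k=0}^{n-1}\left(\int_{t^k}^{t^{k+1}}(t^n-\tau)^{-\alpha}\,d\tau\right)\frac{f(t^{k+1})-f(t^k)}{t^{k+1}-t^k}.$$ The adaptive-memory grid on $[0,\theta]$, with $\theta=2^LT$ and $T=m\Delta t$, is the increasing enumeration of the following points (coinciding endpoints counted once), the last point being the current time $\theta$: the points $t_0^k=(T+2T+\cdots+2^{L-1}T)+k\Delta t=(2^L-1)T+k\Delta t$ for $0\le k\le m$ (spacing $\Delta t$ on $[\theta-T,\theta]$); and, for each $1\le l\le L$, the points $t_l^k=(2^lT+\cdots+2^{L-1}T)+k2^{l-1}\Delta t=(2^L-2^l)T+k2^{l-1}\Delta t$ for $0\le k\le m$ (spacing $2^{l-1}\Delta t$ on $[\theta-2^lT,\theta-2^{l-1}T]$), where the sum in parentheses is empty for $l=L$. *)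

theory Defs
  imports "HOL-Analysis.Analysis"
begin

(* Derivative relative to S: one-sided at the endpoints of a closed interval. *)
definition deriv_on :: "real set \<Rightarrow> (real \<Rightarrow> real) \<Rightarrow> real \<Rightarrow> real" where
  "deriv_on S f x = vector_derivative f (at x within S)"

definition C2_on :: "real set \<Rightarrow> (real \<Rightarrow> real) \<Rightarrow> bool" where
  "C2_on S f \<longleftrightarrow>
     f differentiable_on S \<and> deriv_on S f differentiable_on S \<and>
     continuous_on S (deriv_on S (deriv_on S f))"

(* The kernel is singular only at the endpoint \<tau> = t, where HOL's value 0 for
   the quotient does not affect the integral. *)
definition caputo :: "real \<Rightarrow> (real \<Rightarrow> real) \<Rightarrow> real \<Rightarrow> real" where
  "caputo \<alpha> f t =
     1 / Gamma (1 - \<alpha>) * integral {0..t} (\<lambda>\<tau>. deriv_on {0..t} f \<tau> / (t - \<tau>) powr \<alpha>)"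

definition L1_approx :: "real \<Rightarrow> (real \<Rightarrow> real) \<Rightarrow> (nat \<Rightarrow> real) \<Rightarrow> nat \<Rightarrow> real" where
  "L1_approx \<alpha> f t n =
     1 / Gamma (1 - \<alpha>) *
     (\<Sum>k<n. integral {t k..t (Suc k)} (\<lambda>\<tau>. (t n - \<tau>) powr (- \<alpha>)) *
              ((f (t (Suc k)) - f (t k)) / (t (Suc k) - t k)))"

definition adaptive_points :: "nat \<Rightarrow> nat \<Rightarrow> real \<Rightarrow> real set" where
  "adaptive_points m L dt =
     {(\<Sum>i<L. 2 ^ i * (real m * dt)) + real k * dt |k. k \<le> m} \<union>
     {(\<Sum>i=l..<L. 2 ^ i * (real m * dt)) + real k * (2 ^ (l - 1) * dt) |l k.
        1 \<le> l \<and> l \<le> L \<and> k \<le> m}"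

(* Meaningful for k < card (adaptive_points m L dt). *)
definition adaptive_grid :: "nat \<Rightarrow> nat \<Rightarrow> real \<Rightarrow> nat \<Rightarrow> real" where
  "adaptive_grid m L dt k = sorted_list_of_set (adaptive_points m L dt) ! k"

definition L1_adaptive :: "real \<Rightarrow> (real \<Rightarrow> real) \<Rightarrow> nat \<Rightarrow> nat \<Rightarrow> real \<Rightarrow> real" where
  "L1_adaptive \<alpha> f m L dt =
     L1_approx \<alpha> f (adaptive_grid m L dt) (card (adaptive_points m L dt) - 1)"

definition A_coeff :: "nat \<Rightarrow> real \<Rightarrow> real" where
  "A_coeff m \<alpha> =
     (\<Sum>k<m. (real m - real k) powr (1 - \<alpha>) * (2 * (real m - real k - 1) + \<alpha>)
            - (real m - real k - 1) powr (1 - \<alpha>) * (2 * (real m - real k) - \<alpha>))"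

definition B_coeff :: "nat \<Rightarrow> real \<Rightarrow> real" where
  "B_coeff m \<alpha> =
     (\<Sum>k<m. (2 * real m - real k) powr (1 - \<alpha>) * (2 * (2 * real m - real k - 1) + \<alpha>)
            - (2 * real m - real k - 1) powr (1 - \<alpha>) * (2 * (2 * real m - real k) - \<alpha>))"

lemma sum_dyadic_tail:
  fixes T :: real
  assumes "l \<le> L"
  shows "(\<Sum>i=l..<L. 2 ^ i * T) = (2 ^ L - 2 ^ l) * T"
  using assms by (induction L rule: dec_induct) (auto simp: algebra_simps)

lemma theta_eq:
  fixes T :: real
  shows "T + (\<Sum>i<L. 2 ^ i * T) = 2 ^ L * T"
  using sum_dyadic_tail[of 0 L T] by (simp add: atLeast0LessThan algebra_simps)

lemma finite_adaptive_points: "finite (adaptive_points m L dt)"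
proof -
  have "adaptive_points m L dt =
     (\<lambda>k. (\<Sum>i<L. 2 ^ i * (real m * dt)) + real k * dt) ` {..m} \<union>
     (\<lambda>(l, k). (\<Sum>i=l..<L. 2 ^ i * (real m * dt)) + real k * (2 ^ (l - 1) * dt)) ` ({1..L} \<times> {..m})"
    unfolding adaptive_points_def by (auto simp: image_iff)
  then show ?thesis
    by simp
qed

end

theory Submission
  imports Defs
begin

text \<open>
  The error of the L1 scheme is a sum of contributions of single grid intervals \<open>[a, b]\<close>: on
  each of them \<open>f'\<close> is replaced by the slope \<open>s = (f b - f a) / (b - a)\<close> and the difference is
  integrated against the kernel \<open>(\<theta> - \<tau>) powr (- \<alpha>)\<close>. With \<open>\<bar>f''\<bar> \<le> M\<close>, both functions
  \<open>\<psi> \<tau> = M / 2 * (a + b - 2 * \<tau>) \<plusminus> (f' \<tau> - s)\<close> are decreasing, since \<open>\<psi>' = - M \<plusminus> f'' \<le> 0\<close>, and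
  have mean value zero on \<open>[a, b]\<close>. The kernel is increasing, so by Chebyshev's argument on
  oppositely ordered functions (\<open>integral_decreasing_times_increasing_nonpos\<close>) the integral of
  \<open>\<psi>\<close> times the kernel is nonpositive. Thus the error on \<open>[a, b]\<close> is at most \<open>M / 2\<close> times the
  integral of \<open>2 * \<tau> - a - b\<close> against the kernel (\<open>L1_interval_error\<close>). In contrast to an
  integration by parts, this treats the last interval, where the kernel is singular, like all
  the others.

  The bounding integral is elementary. If the interval has length \<open>h\<close> and \<open>\<theta> - a = x * h\<close>, it is
  \<open>h powr (2 - \<alpha>) / ((1 - \<alpha>) * (2 - \<alpha>))\<close> times the term that occurs in the coefficients \<open>A\<close>
  and \<open>B\<close>, evaluated at \<open>x\<close> (\<open>interval_error_weight\<close>).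

  The adaptive grid consists of \<open>L + 1\<close> blocks of \<open>m\<close> equal intervals. In the block for level
  \<open>l \<ge> 1\<close> the interval number \<open>r\<close> has length \<open>h = 2 ^ (l - 1) * dt\<close> and its left end lies
  \<open>(2 * m - r) * h\<close> before \<open>\<theta>\<close>; in the final block, of step \<open>dt\<close>, this distance is
  \<open>(m - r) * dt\<close>. Adding up the blocks therefore gives \<open>B\<close> once for each level and \<open>A\<close> for the
  final block (\<open>sum_adaptive_weights\<close>), and
  \<open>Gamma (3 - \<alpha>) = (2 - \<alpha>) * (1 - \<alpha>) * Gamma (1 - \<alpha>)\<close> absorbs the constants.
\<close>

section \<open>The error on one grid interval\<close>

text \<open>
  The case \<open>b = c\<close> of an integrable singularity at the right end is included: the primitive is
  still continuous there, and the fundamental theorem needs its derivative in the interior only.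
\<close>
lemma kernel_has_integral:
  fixes \<alpha> a b c p q :: real
  assumes "0 < \<alpha>" "\<alpha> < 1" "a \<le> b" "b \<le> c"
  shows "((\<lambda>\<tau>. (p + q * (c - \<tau>)) * (c - \<tau>) powr (- \<alpha>)) has_integral
      (p * ((c - a) powr (1 - \<alpha>) - (c - b) powr (1 - \<alpha>)) / (1 - \<alpha>)
       + q * ((c - a) powr (2 - \<alpha>) - (c - b) powr (2 - \<alpha>)) / (2 - \<alpha>))) {a..b}"
proof -
  define F where "F \<tau> = - (p * (c - \<tau>) powr (1 - \<alpha>) / (1 - \<alpha>)
      + q * (c - \<tau>) powr (2 - \<alpha>) / (2 - \<alpha>))" for \<tau>
  have "((\<lambda>\<tau>. (p + q * (c - \<tau>)) * (c - \<tau>) powr (- \<alpha>)) has_integral (F b - F a)) {a..b}"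
  proof (rule fundamental_theorem_of_calculus_interior)
    show "continuous_on {a..b} F"
      unfolding F_def using assms by (intro continuous_intros continuous_on_powr') auto
    fix \<tau> assume "\<tau> \<in> {a<..<b}"
    then have pos: "c - \<tau> > 0" using assms by auto
    have power: "((\<lambda>\<tau>. (c - \<tau>) powr s / s) has_real_derivative - ((c - \<tau>) powr (s - 1))) (at \<tau>)"
      if "s \<noteq> 0" for s
      using pos that by (auto intro!: derivative_eq_intros simp: field_simps powr_diff)
    have "(F has_real_derivative
        p * (c - \<tau>) powr (1 - \<alpha> - 1) + q * (c - \<tau>) powr (2 - \<alpha> - 1)) (at \<tau>)"
      unfolding F_def times_divide_eq_right[symmetric]
      using assms pos by (auto intro!: derivative_eq_intros power)
    moreover have "1 - \<alpha> - 1 = - \<alpha>" by simp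
    moreover have "(c - \<tau>) powr (2 - \<alpha> - 1) = (c - \<tau>) * (c - \<tau>) powr (- \<alpha>)"
      using pos powr_add[of "c - \<tau>" 1 "- \<alpha>"] by simp
    ultimately show "(F has_vector_derivative (p + q * (c - \<tau>)) * (c - \<tau>) powr (- \<alpha>)) (at \<tau>)"
      unfolding has_real_derivative_iff_has_vector_derivative[symmetric]
      by (simp only: distrib_right mult.assoc)
  qed (use assms in auto)
  then show ?thesis
    by (rule has_integral_eq_rhs) (simp add: F_def diff_divide_distrib right_diff_distrib)
qed

lemma kernel_times_continuous_integrable:
  fixes \<alpha> a b c :: real
  assumes "0 < \<alpha>" "\<alpha> < 1" "b \<le> c" and cont: "continuous_on {a..b} g"
  shows "(\<lambda>\<tau>. g \<tau> * (c - \<tau>) powr (- \<alpha>)) integrable_on {a..b}"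
proof (cases "a \<le> b")
  case True
  have "(\<lambda>\<tau>. (c - \<tau>) powr (- \<alpha>)) integrable_on {a..b}"
    using kernel_has_integral[of \<alpha> a b c 1 0] True assms by (auto simp: integrable_on_def)
  then have "(\<lambda>\<tau>. (c - \<tau>) powr (- \<alpha>)) absolutely_integrable_on {a..b}"
    by (rule nonnegative_absolutely_integrable_1) simp
  moreover have "g \<in> borel_measurable (lebesgue_on {a..b})"
    using cont by (intro continuous_imp_measurable_on_sets_lebesgue) auto
  moreover have "bounded (g ` {a..b})"
    using cont by (intro compact_imp_bounded compact_continuous_image) auto
  ultimately have "(\<lambda>\<tau>. g \<tau> * (c - \<tau>) powr (- \<alpha>)) absolutely_integrable_on {a..b}"
    by (intro absolutely_integrable_bounded_measurable_product_real) auto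
  then show ?thesis
    by (rule absolutely_integrable_on_def[THEN iffD1, THEN conjunct1])
qed auto

text \<open>
  As \<open>\<psi>\<close> is the derivative of a function with equal values at both ends, it has a zero \<open>z\<close> in the
  interior. By monotonicity \<open>\<psi> x\<close> and \<open>w x - w z\<close> have opposite signs on both sides of \<open>z\<close>, so
  the integral of \<open>\<psi> * w\<close> is at most \<open>w z\<close> times the vanishing integral of \<open>\<psi>\<close>. Monotonicity of
  \<open>w\<close> at \<open>b\<close> is left out of the hypotheses so that \<open>w\<close> may be singular there.
\<close>
lemma integral_decreasing_times_increasing_nonpos:
  fixes H \<psi> w :: "real \<Rightarrow> real"
  assumes "a < b"
    and deriv: "\<And>x. x \<in> {a..b} \<Longrightarrow> (H has_real_derivative \<psi> x) (at x within {a..b})"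
    and "H a = H b"
    and decr: "\<And>x y. a \<le> x \<Longrightarrow> x \<le> y \<Longrightarrow> y \<le> b \<Longrightarrow> \<psi> y \<le> \<psi> x"
    and incr: "\<And>x y. a \<le> x \<Longrightarrow> x \<le> y \<Longrightarrow> y < b \<Longrightarrow> w x \<le> w y"
    and integrable: "(\<lambda>x. \<psi> x * w x) integrable_on {a..b}"
  shows "integral {a..b} (\<lambda>x. \<psi> x * w x) \<le> 0"
proof -
  have int\<psi>: "(\<psi> has_integral 0) {a..b}"
    using fundamental_theorem_of_calculus[of a b H \<psi>] assms
    by (simp add: has_real_derivative_iff_has_vector_derivative)
  have "\<exists>z. a < z \<and> z < b \<and> \<psi> z = 0"
  proof -
    have "continuous_on {a..b} H"
      using deriv by (rule DERIV_continuous_on)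
    moreover have "(H has_derivative (\<lambda>u. \<psi> x * u)) (at x)" if "a < x" "x < b" for x
      using deriv[of x] that by (simp add: at_within_Icc_at has_field_derivative_def)
    ultimately obtain z where "a < z" "z < b" "H b - H a = \<psi> z * (b - a)"
      using mvt[OF \<open>a < b\<close>, of H "\<lambda>x u. \<psi> x * u"] by blast
    then show ?thesis using \<open>H a = H b\<close> by auto
  qed
  then obtain z where z: "a < z" "z < b" "\<psi> z = 0" by blast
  have le: "\<psi> x * w x \<le> \<psi> x * w z" if "x \<in> {a<..<b}" for x
  proof (cases "x \<le> z")
    case True
    then show ?thesis
      using decr[of x z] incr[of x z] z that by (intro mult_left_mono) auto
  next
    case False
    then show ?thesis
      using decr[of z x] incr[of z x] z that by (intro mult_left_mono_neg) auto
  qed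
  have "((\<lambda>x. \<psi> x * w x) has_integral integral {a..b} (\<lambda>x. \<psi> x * w x)) {a<..<b}"
    using integrable integrable_integral by (simp flip: has_integral_Icc_iff_Ioo)
  moreover have "((\<lambda>x. \<psi> x * w z) has_integral 0) {a<..<b}"
    using has_integral_mult_left[OF int\<psi>, of "w z"] by (simp flip: has_integral_Icc_iff_Ioo)
  ultimately show ?thesis
    using le by (rule has_integral_le)
qed

text \<open>
  The right-hand side is the error of a parabola with second derivative \<open>M\<close>: its slope over
  \<open>[a, b]\<close> differs from its derivative by \<open>M / 2 * (2 * \<tau> - a - b)\<close>. Hence the bound is sharp.
\<close>
lemma L1_interval_error:
  fixes f f' f'' :: "real \<Rightarrow> real" and \<alpha> a b c M :: real
  assumes \<alpha>: "0 < \<alpha>" "\<alpha> < 1" and "a < b" "b \<le> c"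
    and f': "\<And>x. x \<in> {a..b} \<Longrightarrow> (f has_real_derivative f' x) (at x within {a..b})"
    and f'': "\<And>x. x \<in> {a..b} \<Longrightarrow> (f' has_real_derivative f'' x) (at x within {a..b})"
    and M: "\<And>x. x \<in> {a..b} \<Longrightarrow> \<bar>f'' x\<bar> \<le> M"
  shows "\<bar>integral {a..b} (\<lambda>\<tau>. f' \<tau> * (c - \<tau>) powr (- \<alpha>))
          - integral {a..b} (\<lambda>\<tau>. (c - \<tau>) powr (- \<alpha>)) * ((f b - f a) / (b - a))\<bar>
         \<le> M / 2 * integral {a..b} (\<lambda>\<tau>. (2 * \<tau> - a - b) * (c - \<tau>) powr (- \<alpha>))"
proof -
  define k where "k = (f b - f a) / (b - a)"
  define w where "w \<tau> = (c - \<tau>) powr (- \<alpha>)" for \<tau>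
  have "continuous_on {a..b} f'"
    using f'' by (rule DERIV_continuous_on)
  then have int1: "((\<lambda>\<tau>. f' \<tau> * w \<tau>) has_integral integral {a..b} (\<lambda>\<tau>. f' \<tau> * w \<tau>)) {a..b}"
    using kernel_times_continuous_integrable[of \<alpha> b c a f'] assms
    by (simp add: w_def integrable_integral)
  have int0: "(w has_integral integral {a..b} w) {a..b}"
    using kernel_times_continuous_integrable[of \<alpha> b c a "\<lambda>_. 1"] assms
    by (simp add: w_def[abs_def] integrable_integral)
  have int2: "((\<lambda>\<tau>. (2 * \<tau> - a - b) * w \<tau>) has_integral
      integral {a..b} (\<lambda>\<tau>. (2 * \<tau> - a - b) * w \<tau>)) {a..b}"
    using kernel_times_continuous_integrable[of \<alpha> b c a "\<lambda>\<tau>. 2 * \<tau> - a - b"] assms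
    by (simp add: w_def integrable_integral continuous_intros)
  \<comment> \<open>The signs \<open>s = 1\<close> and \<open>s = - 1\<close> give the two halves of the bound on the absolute value.\<close>
  have key: "s * (integral {a..b} (\<lambda>\<tau>. f' \<tau> * w \<tau>) - integral {a..b} w * k)
      \<le> M / 2 * integral {a..b} (\<lambda>\<tau>. (2 * \<tau> - a - b) * w \<tau>)"
    if s: "\<bar>s\<bar> = 1" for s
  proof -
    define H where "H \<tau> = M / 2 * ((\<tau> - a) * (b - \<tau>)) + s * (f \<tau> - k * \<tau>)" for \<tau>
    define \<psi> where "\<psi> \<tau> = M / 2 * (a + b - 2 * \<tau>) + s * (f' \<tau> - k)" for \<tau>
    have H\<psi>: "(H has_real_derivative \<psi> x) (at x within {a..b})" if "x \<in> {a..b}" for x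
      unfolding H_def \<psi>_def using f'[OF that]
      by (auto intro!: derivative_eq_intros simp: algebra_simps)
    have \<psi>': "(\<psi> has_real_derivative (- M + s * f'' x)) (at x within {a..b})"
      if "x \<in> {a..b}" for x
      unfolding \<psi>_def using f''[OF that] by (auto intro!: derivative_eq_intros)
    have sM: "- M + s * f'' x \<le> 0" if "x \<in> {a..b}" for x
      using M[OF that] s abs_mult[of s "f'' x"] abs_ge_self[of "s * f'' x"] by simp
    have "\<psi> y \<le> \<psi> x" if "a \<le> x" "x \<le> y" "y \<le> b" for x y
    proof (rule DERIV_nonpos_imp_decreasing_open[OF \<open>x \<le> y\<close>])
      show "continuous_on {x..y} \<psi>"
        using \<psi>' that by (meson DERIV_continuous_on continuous_on_subset atLeastatMost_subset_iff)
      fix u assume "x < u" "u < y"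
      then have "(\<psi> has_real_derivative (- M + s * f'' u)) (at u)"
        using \<psi>'[of u] that by (simp add: at_within_Icc_at)
      then show "\<exists>d. (\<psi> has_real_derivative d) (at u) \<and> d \<le> 0"
        using sM[of u] that \<open>x < u\<close> \<open>u < y\<close> by force
    qed
    moreover have "H a = H b"
      unfolding H_def k_def using \<open>a < b\<close> by (simp add: field_simps)
    moreover have "w x \<le> w y" if "a \<le> x" "x \<le> y" "y < b" for x y
      unfolding w_def using that \<alpha> \<open>b \<le> c\<close> by (intro powr_mono2') auto
    moreover have combined: "((\<lambda>\<tau>. \<psi> \<tau> * w \<tau>) has_integral
        s * (integral {a..b} (\<lambda>\<tau>. f' \<tau> * w \<tau>) - k * integral {a..b} w)
        - M / 2 * integral {a..b} (\<lambda>\<tau>. (2 * \<tau> - a - b) * w \<tau>)) {a..b}"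
      using has_integral_diff[OF has_integral_mult_right[OF has_integral_diff[OF int1
            has_integral_mult_right[OF int0, of k]], of s] has_integral_mult_right[OF int2, of "M / 2"]]
      by (rule has_integral_eq[rotated]) (simp add: \<psi>_def algebra_simps)
    ultimately have "integral {a..b} (\<lambda>\<tau>. \<psi> \<tau> * w \<tau>) \<le> 0"
      using integral_decreasing_times_increasing_nonpos[OF \<open>a < b\<close> H\<psi>, of w]
      by (meson has_integral_integrable)
    with combined show ?thesis
      by (simp add: integral_unique mult.commute)
  qed
  have "\<bar>integral {a..b} (\<lambda>\<tau>. f' \<tau> * w \<tau>) - integral {a..b} w * k\<bar>
      \<le> M / 2 * integral {a..b} (\<lambda>\<tau>. (2 * \<tau> - a - b) * w \<tau>)"
    using key[of 1, OF abs_one] key[of "-1", OF abs_neg_one]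
    by (simp only: abs_le_iff mult_1 mult_minus1 simp_thms)
  then show ?thesis
    unfolding k_def w_def[abs_def] .
qed

text \<open>
  In the variable \<open>c - \<tau>\<close> the integrand is \<open>((2 * x - 1) * h - 2 * (c - \<tau>)) * (c - \<tau>) powr (- \<alpha>)\<close>,
  and \<open>c - \<tau>\<close> runs from \<open>(x - 1) * h\<close> to \<open>x * h\<close>; the powers of \<open>h\<close> then factor out.
  The case \<open>x = 1\<close> is the interval that ends at the singularity.
\<close>
lemma interval_error_weight:
  fixes \<alpha> a b c h x :: real
  assumes \<alpha>: "0 < \<alpha>" "\<alpha> < 1" and "0 < h" "1 \<le> x" "b - a = h" "c - a = x * h"
  shows "integral {a..b} (\<lambda>\<tau>. (2 * \<tau> - a - b) * (c - \<tau>) powr (- \<alpha>))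
    = h powr (2 - \<alpha>) / ((1 - \<alpha>) * (2 - \<alpha>)) *
      (x powr (1 - \<alpha>) * (2 * (x - 1) + \<alpha>) - (x - 1) powr (1 - \<alpha>) * (2 * x - \<alpha>))"
proof -
  have cb: "c - b = (x - 1) * h" using assms by (simp add: algebra_simps)
  have split: "u powr (2 - \<alpha>) = u * u powr (1 - \<alpha>)" if "u \<ge> 0" for u :: real
    using that powr_add[of u 1 "1 - \<alpha>"] by (cases "u = 0") auto
  have "a \<le> b" "b \<le> c"
    using assms cb by (auto simp: algebra_simps intro: mult_right_mono)
  then have "((\<lambda>\<tau>. ((2 * x - 1) * h + (-2) * (c - \<tau>)) * (c - \<tau>) powr (- \<alpha>)) has_integral
      ((2 * x - 1) * h * ((c - a) powr (1 - \<alpha>) - (c - b) powr (1 - \<alpha>)) / (1 - \<alpha>)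
       + (-2) * ((c - a) powr (2 - \<alpha>) - (c - b) powr (2 - \<alpha>)) / (2 - \<alpha>))) {a..b}"
    using \<alpha> by (intro kernel_has_integral)
  moreover have "(2 * x - 1) * h + (-2) * (c - \<tau>) = 2 * \<tau> - a - b" for \<tau>
    using assms by (simp add: algebra_simps)
  ultimately have "((\<lambda>\<tau>. (2 * \<tau> - a - b) * (c - \<tau>) powr (- \<alpha>)) has_integral
      ((2 * x - 1) * h * ((c - a) powr (1 - \<alpha>) - (c - b) powr (1 - \<alpha>)) / (1 - \<alpha>)
       + (-2) * ((c - a) powr (2 - \<alpha>) - (c - b) powr (2 - \<alpha>)) / (2 - \<alpha>))) {a..b}"
    by (simp only:)
  then have "integral {a..b} (\<lambda>\<tau>. (2 * \<tau> - a - b) * (c - \<tau>) powr (- \<alpha>)) =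
      (2 * x - 1) * h * ((c - a) powr (1 - \<alpha>) - (c - b) powr (1 - \<alpha>)) / (1 - \<alpha>)
       + (-2) * ((c - a) powr (2 - \<alpha>) - (c - b) powr (2 - \<alpha>)) / (2 - \<alpha>)"
    by (rule integral_unique)
  also have "\<dots> = h powr (2 - \<alpha>) / ((1 - \<alpha>) * (2 - \<alpha>)) *
      (x powr (1 - \<alpha>) * (2 * (x - 1) + \<alpha>) - (x - 1) powr (1 - \<alpha>) * (2 * x - \<alpha>))"
    unfolding cb \<open>c - a = x * h\<close> using assms
    by (simp add: split powr_mult divide_simps) (simp add: algebra_simps)
  finally show ?thesis .
qed

section \<open>Summation over a grid\<close>

lemma integral_sum_grid:
  fixes g :: "real \<Rightarrow> real" and t :: "nat \<Rightarrow> real"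
  assumes "mono t" and "g integrable_on {t 0..t n}"
  shows "integral {t 0..t n} g = (\<Sum>k<n. integral {t k..t (Suc k)} g)"
  using assms(2)
proof (induction n)
  case (Suc n)
  have le: "t 0 \<le> t n" "t n \<le> t (Suc n)"
    by (simp_all add: monoD[OF \<open>mono t\<close>])
  then have "g integrable_on {t 0..t n}"
    using Suc.prems by (auto intro: integrable_on_subinterval)
  then show ?case
    using Suc Henstock_Kurzweil_Integration.integral_combine[OF le Suc.prems] by simp
qed simp

lemma L1_grid_error:
  fixes f f' f'' :: "real \<Rightarrow> real" and \<alpha> M :: real and t :: "nat \<Rightarrow> real"
  assumes \<alpha>: "0 < \<alpha>" "\<alpha> < 1" and t: "strict_mono t"
    and f': "\<And>x. x \<in> {t 0..t n} \<Longrightarrow> (f has_real_derivative f' x) (at x within {t 0..t n})"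
    and f'': "\<And>x. x \<in> {t 0..t n} \<Longrightarrow> (f' has_real_derivative f'' x) (at x within {t 0..t n})"
    and M: "\<And>x. x \<in> {t 0..t n} \<Longrightarrow> \<bar>f'' x\<bar> \<le> M"
  shows "\<bar>integral {t 0..t n} (\<lambda>\<tau>. f' \<tau> * (t n - \<tau>) powr (- \<alpha>))
          - (\<Sum>k<n. integral {t k..t (Suc k)} (\<lambda>\<tau>. (t n - \<tau>) powr (- \<alpha>)) *
              ((f (t (Suc k)) - f (t k)) / (t (Suc k) - t k)))\<bar>
         \<le> (\<Sum>k<n. M / 2 * integral {t k..t (Suc k)}
              (\<lambda>\<tau>. (2 * \<tau> - t k - t (Suc k)) * (t n - \<tau>) powr (- \<alpha>)))"
proof -
  have mono: "mono t" using t by (rule strict_mono_mono)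
  have "continuous_on {t 0..t n} f'"
    using f'' by (rule DERIV_continuous_on)
  then have "(\<lambda>\<tau>. f' \<tau> * (t n - \<tau>) powr (- \<alpha>)) integrable_on {t 0..t n}"
    using \<alpha> by (intro kernel_times_continuous_integrable) auto
  note split = integral_sum_grid[OF mono this]
  show ?thesis
    unfolding split sum_subtractf[symmetric]
  proof (rule order_trans[OF sum_abs], rule sum_mono, rule L1_interval_error[OF \<alpha>])
    fix k assume "k \<in> {..<n}"
    then have k: "t 0 \<le> t k" "t k < t (Suc k)" "t (Suc k) \<le> t n"
      by (simp_all add: monoD[OF mono] strict_monoD[OF t])
    show "t k < t (Suc k)" "t (Suc k) \<le> t n" using k by auto
    fix x assume x: "x \<in> {t k..t (Suc k)}"
    with k have "x \<in> {t 0..t n}" by auto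
    moreover have "{t k..t (Suc k)} \<subseteq> {t 0..t n}" using k by auto
    ultimately show "(f has_real_derivative f' x) (at x within {t k..t (Suc k)})"
      "(f' has_real_derivative f'' x) (at x within {t k..t (Suc k)})" "\<bar>f'' x\<bar> \<le> M"
      using f' f'' M by (blast intro: DERIV_subset)+
  qed
qed

section \<open>The adaptive-memory grid\<close>

text \<open>
  Blocks are numbered from left to right, so block \<open>j < L\<close> is level \<open>l = L - j\<close>, of step
  \<open>2 ^ (l - 1) * dt\<close>. For \<open>j = L\<close> the truncated subtraction \<open>L - Suc j = 0\<close> yields the step \<open>dt\<close>
  of the final block, which is the same as the step of level 1.
\<close>
definition adaptive_step :: "nat \<Rightarrow> real \<Rightarrow> nat \<Rightarrow> real" where
  "adaptive_step L dt j = 2 ^ (L - Suc j) * dt"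

text \<open>
  Defining the nodes as partial sums of the steps makes it evident that they increase, and counts
  the common endpoint of adjacent blocks only once.
\<close>
definition adaptive_node :: "nat \<Rightarrow> nat \<Rightarrow> real \<Rightarrow> nat \<Rightarrow> real" where
  "adaptive_node m L dt k = (\<Sum>i<k. adaptive_step L dt (i div m))"

lemma strict_mono_adaptive_node:
  assumes "0 < dt"
  shows "strict_mono (adaptive_node m L dt)"
  using assms by (simp add: strict_mono_Suc_iff adaptive_node_def adaptive_step_def)

text \<open>
  Allowing \<open>r = m\<close>, one describes the endpoint shared with the next block in a second way; this
  matches the description of the grid as a union of overlapping levels.
\<close>
lemma adaptive_node_block:
  assumes "j \<le> L" "r \<le> m"
  shows "adaptive_node m L dt (j * m + r) =
    (2 ^ L - 2 ^ (L - j)) * (real m * dt) + real r * adaptive_step L dt j"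
proof -
  have within: "adaptive_node m L dt (j * m + r) =
      adaptive_node m L dt (j * m) + real r * adaptive_step L dt j" if "r \<le> m" for j r
    using that
  proof (induction r)
    case (Suc r)
    then have "(j * m + r) div m = j" by simp
    then show ?case
      using Suc by (simp add: adaptive_node_def algebra_simps)
  qed simp
  have "adaptive_node m L dt (j * m) = (2 ^ L - 2 ^ (L - j)) * (real m * dt)"
    using \<open>j \<le> L\<close>
  proof (induction j)
    case 0
    then show ?case by (simp add: adaptive_node_def)
  next
    case (Suc j)
    then have "L - j = Suc (L - Suc j)" by simp
    then show ?case
      using Suc within[of m j] by (simp add: adaptive_step_def algebra_simps)
  qed
  with within[OF \<open>r \<le> m\<close>] show ?thesis by simp
qed

lemma adaptive_node_last: "adaptive_node m L dt (Suc L * m) = 2 ^ L * (real m * dt)"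
  using adaptive_node_block[of L L m m dt]
  by (simp add: adaptive_step_def algebra_simps)

lemma adaptive_points_eq_nodes:
  assumes "1 \<le> m"
  shows "adaptive_points m L dt = adaptive_node m L dt ` {..Suc L * m}"
proof (intro equalityI subsetI)
  fix x assume "x \<in> adaptive_points m L dt"
  then consider k where "k \<le> m" "x = (\<Sum>i<L. 2 ^ i * (real m * dt)) + real k * dt"
    | l k where "1 \<le> l" "l \<le> L" "k \<le> m"
      "x = (\<Sum>i=l..<L. 2 ^ i * (real m * dt)) + real k * (2 ^ (l - 1) * dt)"
    unfolding adaptive_points_def by blast
  then obtain j k where jk: "j \<le> L" "k \<le> m" "x = adaptive_node m L dt (j * m + k)"
  proof cases
    case (1 k)
    show ?thesis
      by (rule that[of L k]) (use 1 in \<open>simp_all add: adaptive_node_block adaptive_step_def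
        sum_dyadic_tail[of 0 L, simplified atLeast0LessThan]\<close>)
  next
    case (2 l k)
    show ?thesis
      by (rule that[of "L - l" k])
        (use 2 in \<open>simp_all add: adaptive_node_block adaptive_step_def sum_dyadic_tail\<close>)
  qed
  have "j * m + k \<le> Suc L * m"
    using jk mult_le_mono1[of j L m] unfolding mult_Suc by linarith
  with jk show "x \<in> adaptive_node m L dt ` {..Suc L * m}" by blast
next
  fix x assume "x \<in> adaptive_node m L dt ` {..Suc L * m}"
  then obtain i where i: "i \<le> Suc L * m" "x = adaptive_node m L dt i" by blast
  obtain j r where jr: "j \<le> L" "r \<le> m" "i = j * m + r"
  proof (cases "i = Suc L * m")
    case True
    then show ?thesis by (intro that[of L m]) auto
  next
    case False
    then have "i < Suc L * m" using i by simp
    then have "i div m < Suc L" by (rule less_mult_imp_div_less)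
    moreover have "i mod m \<le> m" using assms by (simp add: less_imp_le)
    ultimately show ?thesis by (intro that[of "i div m" "i mod m"]) auto
  qed
  have x: "x = (2 ^ L - 2 ^ (L - j)) * (real m * dt) + real r * adaptive_step L dt j"
    using i(2) jr adaptive_node_block by simp
  show "x \<in> adaptive_points m L dt"
  proof (cases "j = L")
    case True
    then have "x = (\<Sum>i<L. 2 ^ i * (real m * dt)) + real r * dt"
      using x by (simp add: adaptive_step_def sum_dyadic_tail[of 0 L, simplified atLeast0LessThan])
    then show ?thesis using jr unfolding adaptive_points_def by blast
  next
    case False
    then have "x = (\<Sum>i=L-j..<L. 2 ^ i * (real m * dt)) + real r * (2 ^ (L - j - 1) * dt)"
      using x by (simp add: adaptive_step_def sum_dyadic_tail)
    moreover have "1 \<le> L - j" "L - j \<le> L" using False jr by auto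
    ultimately show ?thesis using jr unfolding adaptive_points_def by blast
  qed
qed

text \<open>
  The sorted enumeration of a finite set is its only strictly increasing enumeration, and
  \<^const>\<open>adaptive_node\<close> is such an enumeration of the grid.
\<close>
lemma adaptive_grid_eq_node:
  assumes "1 \<le> m" "0 < dt"
  shows "card (adaptive_points m L dt) = Suc (Suc L * m)"
    and "k \<le> Suc L * m \<Longrightarrow> adaptive_grid m L dt k = adaptive_node m L dt k"
proof -
  let ?n = "Suc L * m"
  have mono: "strict_mono (adaptive_node m L dt)"
    using assms by (intro strict_mono_adaptive_node)
  then have "inj_on (adaptive_node m L dt) {..?n}"
    using strict_mono_imp_inj_on inj_on_subset by blast
  then show "card (adaptive_points m L dt) = Suc ?n"
    by (simp add: adaptive_points_eq_nodes[OF assms(1)] card_image del: mult_Suc)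
  have "sorted_list_of_set (adaptive_points m L dt) = map (adaptive_node m L dt) [0..<Suc ?n]"
  proof (rule strict_sorted_equal)
    show "sorted_wrt (<) (map (adaptive_node m L dt) [0..<Suc ?n])"
      unfolding sorted_wrt_map
      by (rule sorted_wrt_mono_rel[OF _ sorted_wrt_upt]) (use mono in \<open>simp add: strict_mono_less\<close>)
    show "set (sorted_list_of_set (adaptive_points m L dt)) =
        set (map (adaptive_node m L dt) [0..<Suc ?n])"
      using finite_adaptive_points[of m L dt]
      by (simp add: adaptive_points_eq_nodes[OF assms(1)] atLeast0LessThan lessThan_Suc_atMost
          del: upt_Suc mult_Suc)
  qed simp
  then show "adaptive_grid m L dt k = adaptive_node m L dt k" if "k \<le> ?n"
    using that by (simp add: adaptive_grid_def del: upt_Suc mult_Suc)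
qed

text \<open>
  Measured in units of the local step \<open>h\<close>, the distance from an interval to \<open>\<theta> = t n\<close> depends
  only on the position \<open>r\<close> inside the block, not on the level. This self-similarity is the reason
  why a single coefficient \<open>B\<close> serves all levels.
\<close>
lemma sum_adaptive_weights:
  fixes \<alpha> dt :: real and m L :: nat
  assumes \<alpha>: "0 < \<alpha>" "\<alpha> < 1" and "1 \<le> m" "0 < dt"
  defines "t \<equiv> adaptive_node m L dt" and "n \<equiv> Suc L * m"
  shows "(\<Sum>k<n. integral {t k..t (Suc k)}
      (\<lambda>\<tau>. (2 * \<tau> - t k - t (Suc k)) * (t n - \<tau>) powr (- \<alpha>)))
    = 1 / ((1 - \<alpha>) * (2 - \<alpha>)) * (dt powr (2 - \<alpha>) * A_coeff m \<alpha> +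
        (\<Sum>l=1..L. (2 ^ (l - 1) * dt) powr (2 - \<alpha>) * B_coeff m \<alpha>))"
proof -
  define W where "W k = integral {t k..t (Suc k)}
      (\<lambda>\<tau>. (2 * \<tau> - t k - t (Suc k)) * (t n - \<tau>) powr (- \<alpha>))" for k
  define E where "E x = x powr (1 - \<alpha>) * (2 * (x - 1) + \<alpha>) - (x - 1) powr (1 - \<alpha>) * (2 * x - \<alpha>)"
    for x :: real
  define C where "C = 1 / ((1 - \<alpha>) * (2 - \<alpha>))"
  have W: "W (j * m + r) = C * (adaptive_step L dt j powr (2 - \<alpha>) * E x)"
    if "j \<le> L" "r < m" "1 \<le> x" "t n - t (j * m + r) = x * adaptive_step L dt j" for j r x
  proof -
    have "t (Suc (j * m + r)) - t (j * m + r) = adaptive_step L dt j"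
      using that by (simp add: t_def adaptive_node_def)
    moreover have "0 < adaptive_step L dt j"
      using \<open>0 < dt\<close> by (simp add: adaptive_step_def)
    ultimately show ?thesis
      unfolding W_def C_def E_def using that \<alpha> by (subst interval_error_weight) auto
  qed
  have last: "t n = 2 ^ L * (real m * dt)"
    unfolding t_def n_def by (rule adaptive_node_last)
  have A: "(\<Sum>r<m. W (L * m + r)) = C * (dt powr (2 - \<alpha>) * A_coeff m \<alpha>)"
  proof -
    have "W (L * m + r) = C * (dt powr (2 - \<alpha>) * E (real m - real r))" if "r < m" for r
    proof (subst W[OF order_refl that])
      show "1 \<le> real m - real r" using that by linarith
      show "t n - t (L * m + r) = (real m - real r) * adaptive_step L dt L"
        unfolding last unfolding t_def adaptive_node_block[OF order_refl less_imp_le[OF that]]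
        by (simp add: adaptive_step_def algebra_simps)
    qed (simp add: adaptive_step_def)
    then show ?thesis
      by (simp add: A_coeff_def E_def sum_distrib_left)
  qed
  have B: "(\<Sum>r<m. W (j * m + r)) =
      C * ((2 ^ (L - Suc j) * dt) powr (2 - \<alpha>) * B_coeff m \<alpha>)" if "j < L" for j
  proof -
    have "W (j * m + r) = C * ((2 ^ (L - Suc j) * dt) powr (2 - \<alpha>) * E (2 * real m - real r))"
      if "r < m" for r
    proof (subst W[OF less_imp_le[OF \<open>j < L\<close>] that])
      show "1 \<le> 2 * real m - real r" using that by linarith
      have "(2::real) ^ (L - j) = 2 * 2 ^ (L - Suc j)"
        using \<open>j < L\<close> by (simp flip: power_Suc add: Suc_diff_Suc)
      then show "t n - t (j * m + r) = (2 * real m - real r) * adaptive_step L dt j"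
        unfolding last
        unfolding t_def adaptive_node_block[OF less_imp_le[OF \<open>j < L\<close>] less_imp_le[OF that]]
        by (simp add: adaptive_step_def algebra_simps)
    qed (simp add: adaptive_step_def)
    then show ?thesis
      by (simp add: B_coeff_def E_def sum_distrib_left)
  qed
  \<comment> \<open>Every index below \<open>n\<close> is \<open>j * m + r\<close> for exactly one block \<open>j\<close> and one \<open>r < m\<close>.\<close>
  have "(\<Sum>k<n. W k) = (\<Sum>j<Suc L. \<Sum>r<m. W (j * m + r))"
  proof -
    have "(\<Sum>k\<in>{j * m..<j * m + m}. W k) = (\<Sum>r<m. W (j * m + r))" for j
      using sum.shift_bounds_nat_ivl[of W 0 "j * m" m] by (simp add: atLeast0LessThan add.commute)
    then show ?thesis
      unfolding n_def sum.nat_group[symmetric, of W "Suc L" m] by simp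
  qed
  also have "\<dots> = C * (dt powr (2 - \<alpha>) * A_coeff m \<alpha>) +
      (\<Sum>j<L. C * ((2 ^ (L - Suc j) * dt) powr (2 - \<alpha>) * B_coeff m \<alpha>))"
    by (simp add: A B)
  also have "(\<Sum>j<L. C * ((2 ^ (L - Suc j) * dt) powr (2 - \<alpha>) * B_coeff m \<alpha>))
      = (\<Sum>l=1..L. C * ((2 ^ (l - 1) * dt) powr (2 - \<alpha>) * B_coeff m \<alpha>))"
    by (rule sum.reindex_bij_witness[of _ "\<lambda>l. L - l" "\<lambda>j. L - j"]) auto
  finally show ?thesis
    unfolding W_def C_def by (simp add: sum_distrib_left distrib_left)
qed

section \<open>The error estimate\<close>

lemma C2_on_derivatives:
  assumes "C2_on S f" "x \<in> S"
  shows "(f has_real_derivative deriv_on S f x) (at x within S)"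
    and "(deriv_on S f has_real_derivative deriv_on S (deriv_on S f) x) (at x within S)"
  using assms
  by (auto simp: C2_on_def differentiable_on_def deriv_on_def
      has_real_derivative_iff_has_vector_derivative vector_derivative_works)

lemma Gamma_3_minus:
  fixes \<alpha> :: real
  assumes "\<alpha> < 1"
  shows "Gamma (3 - \<alpha>) = (2 - \<alpha>) * (1 - \<alpha>) * Gamma (1 - \<alpha>)"
proof -
  have "1 - \<alpha> \<notin> \<int>\<^sub>\<le>\<^sub>0" "2 - \<alpha> \<notin> \<int>\<^sub>\<le>\<^sub>0"
    using assms by auto
  moreover have "1 - \<alpha> + 1 = 2 - \<alpha>" "2 - \<alpha> + 1 = 3 - \<alpha>" by simp_all
  ultimately show ?thesis
    using Gamma_plus1[of "1 - \<alpha>"] Gamma_plus1[of "2 - \<alpha>"] by (simp only: mult.assoc simp_thms)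
qed

theorem mainTheorem1:
  fixes \<alpha> dt T \<theta> M :: real and m L :: nat and f :: "real \<Rightarrow> real"
  assumes "0 < \<alpha>" and "\<alpha> < 1"
    and "1 \<le> m" and "1 \<le> L"
    and "0 < dt"
    and "T = real m * dt"
    and "\<theta> = T + (\<Sum>i<L. 2 ^ i * T)"
    and "C2_on {0..\<theta>} f"
    and "\<exists>\<tau>\<in>{0..\<theta>}. \<bar>deriv_on {0..\<theta>} (deriv_on {0..\<theta>} f) \<tau>\<bar> = M"
    and "\<forall>\<tau>\<in>{0..\<theta>}. \<bar>deriv_on {0..\<theta>} (deriv_on {0..\<theta>} f) \<tau>\<bar> \<le> M"
  shows "\<bar>caputo \<alpha> f \<theta> - L1_adaptive \<alpha> f m L dt\<bar>
         \<le> M / (2 * Gamma (3 - \<alpha>)) *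
           (dt powr (2 - \<alpha>) * A_coeff m \<alpha> +
            (\<Sum>l=1..L. (2 ^ (l - 1) * dt) powr (2 - \<alpha>) * B_coeff m \<alpha>))"
proof -
  define t where "t = adaptive_node m L dt"
  define n where "n = Suc L * m"
  define R where "R = dt powr (2 - \<alpha>) * A_coeff m \<alpha> +
            (\<Sum>l=1..L. (2 ^ (l - 1) * dt) powr (2 - \<alpha>) * B_coeff m \<alpha>)"
  define S where "S = (\<Sum>k<n. integral {t k..t (Suc k)} (\<lambda>\<tau>. (t n - \<tau>) powr (- \<alpha>)) *
              ((f (t (Suc k)) - f (t k)) / (t (Suc k) - t k)))"
  define J where "J = integral {0..\<theta>} (\<lambda>\<tau>. deriv_on {0..\<theta>} f \<tau> * (\<theta> - \<tau>) powr (- \<alpha>))"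
  have t0: "t 0 = 0" by (simp add: t_def adaptive_node_def)
  have tn: "t n = \<theta>"
    using theta_eq[of T L] assms by (simp add: t_def n_def adaptive_node_last del: mult_Suc)
  have "strict_mono t"
    unfolding t_def using \<open>0 < dt\<close> by (rule strict_mono_adaptive_node)
  then have "\<bar>J - S\<bar> \<le> (\<Sum>k<n. M / 2 * integral {t k..t (Suc k)}
              (\<lambda>\<tau>. (2 * \<tau> - t k - t (Suc k)) * (t n - \<tau>) powr (- \<alpha>)))"
    using L1_grid_error[OF assms(1,2), of t n f "deriv_on {0..\<theta>} f"
        "deriv_on {0..\<theta>} (deriv_on {0..\<theta>} f)" M] C2_on_derivatives[OF \<open>C2_on {0..\<theta>} f\<close>] assms(10)
    unfolding t0 tn J_def S_def by blast
  also have "\<dots> = M / 2 * (1 / ((1 - \<alpha>) * (2 - \<alpha>)) * R)"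
    unfolding sum_distrib_left[symmetric] R_def t_def n_def
    using sum_adaptive_weights[of \<alpha> m dt L] assms by simp
  finally have bound: "\<bar>J - S\<bar> \<le> M / 2 * (1 / ((1 - \<alpha>) * (2 - \<alpha>)) * R)" .
  \<comment> \<open>At \<open>\<tau> = \<theta>\<close> both forms of the integrand are 0, by the conventions for \<open>x / 0\<close> and \<open>0 powr x\<close>.\<close>
  have caputo: "caputo \<alpha> f \<theta> = 1 / Gamma (1 - \<alpha>) * J"
    by (simp add: caputo_def J_def powr_minus_divide)
  have L1: "L1_adaptive \<alpha> f m L dt = 1 / Gamma (1 - \<alpha>) * S"
    using assms by (simp add: L1_adaptive_def L1_approx_def adaptive_grid_eq_node S_def t_def n_def
        del: mult_Suc)
  have pos: "Gamma (1 - \<alpha>) > 0" using \<open>\<alpha> < 1\<close> by (intro Gamma_real_pos) simp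
  have "\<bar>caputo \<alpha> f \<theta> - L1_adaptive \<alpha> f m L dt\<bar> = \<bar>J - S\<bar> / Gamma (1 - \<alpha>)"
    unfolding caputo L1 using pos by (simp add: abs_mult flip: diff_divide_distrib)
  also have "\<dots> \<le> M / 2 * (1 / ((1 - \<alpha>) * (2 - \<alpha>)) * R) / Gamma (1 - \<alpha>)"
    using bound pos by (intro divide_right_mono) auto
  also have "\<dots> = M / (2 * Gamma (3 - \<alpha>)) * R"
    using \<open>\<alpha> < 1\<close> by (simp add: Gamma_3_minus mult_ac)
  finally show ?thesis unfolding R_def .
qed

end
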